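(* Let $k\ge 1$ and let $N_k>\cdots>N_2>N_1>N_0=0$ be integers in generic position. Then there is a one-to-one correspondence between rooted binary trees with $k$ leaves and election processes on team hierarchies with $k$ layers (of sizes $N_k > \cdots > N_1$).
   Context: Generic position: $N_j-N_i\neq N_m-N_p$ for all distinct pairs $(j,i)\ne(m,p)$ with $j>i\ge 0$ and $m>p\ge 0$. Rooted binary trees are plane trees in which every internal node has exactly two children (left and right); the tree with $k=1$ leaf is a single vertex. Election processes: consider the formal product of binomial coefficients $$\binom{N_k}{N_{k-1}}\cdots\binom{N_3}{N_2}\binom{N_2}{N_1}$$ (the empty product if $k=1$). An election process on a team hierarchy with $k$ layers is any formal product of binomial coefficient symbols, considered up to permutation of the factors, obtained from this product by successive application (zero or more times) of the trinomial revision identity $\binom{a}{b}\binom{b}{c}=\binom{a}{c}\binom{a-c}{b-c}$, that is, by successively replacing pairs of factors according to $$\binom{N_j-N_{i-1}}{N_m-N_{i-1}}\binom{N_m-N_{i-1}}{N_{p-1}-N_{i-1}} \;\longmapsto\; \binom{N_j-N_{i-1}}{N_{p-1}-N_{i-1}}\binom{N_j-N_{p-1}}{N_m-N_{p-1}}$$ where $j>m\ge p>i\ge 1$. *)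

theory Defs
  imports Main "HOL-Library.Multiset" "HOL-Library.Tree"
begin

text \<open>A formal binomial symbol records its two integer entries and is never evaluated: the
  symbols with entries \<open>a, b\<close> and \<open>a, a - b\<close> are different whenever \<open>b \<noteq> a - b\<close>.\<close>

datatype binom_symbol = Binom int int

text \<open>A formal product of symbols, considered up to permutation of its factors, is a multiset.\<close>

type_synonym formal_product = "binom_symbol multiset"

text \<open>Only the values \<open>N 0, \<dots>, N k\<close> are layer sizes; the function \<open>N\<close> is arbitrary beyond \<open>k\<close>,
  so every index below is bounded by \<open>k\<close>.\<close>

definition generic_position :: "nat \<Rightarrow> (nat \<Rightarrow> int) \<Rightarrow> bool" where
  "generic_position k N \<longleftrightarrow>
    (\<forall>j i m p. j \<le> k \<and> m \<le> k \<and> j > i \<and> m > p \<and> (j, i) \<noteq> (m, p) \<longrightarrow> N j - N i \<noteq> N m - N p)"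

definition initial_product :: "nat \<Rightarrow> (nat \<Rightarrow> int) \<Rightarrow> formal_product" where
  "initial_product k N = image_mset (\<lambda>j. Binom (N (j + 1)) (N j)) (mset_set {1..<k})"

text \<open>One left-to-right application of
  \<open>binom a b * binom b c = binom a c * binom (a - c) (b - c)\<close> to two factors of a product, where
  \<open>a = N j - N (i - 1)\<close>, \<open>b = N m - N (i - 1)\<close> and \<open>c = N (p - 1) - N (i - 1)\<close>. The index
  subtractions are never truncated, since \<open>p > i \<ge> 1\<close>.\<close>

inductive revision :: "nat \<Rightarrow> (nat \<Rightarrow> int) \<Rightarrow> formal_product \<Rightarrow> formal_product \<Rightarrow> bool"
  for k :: nat and N :: "nat \<Rightarrow> int" where
  "\<lbrakk>j \<le> k; j > m; m \<ge> p; p > i; i \<ge> 1\<rbrakk> \<Longrightarrow>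
    revision k N
      (M + {#Binom (N j - N (i - 1)) (N m - N (i - 1)),
             Binom (N m - N (i - 1)) (N (p - 1) - N (i - 1))#})
      (M + {#Binom (N j - N (i - 1)) (N (p - 1) - N (i - 1)),
             Binom (N j - N (p - 1)) (N m - N (p - 1))#})"

definition election_processes :: "nat \<Rightarrow> (nat \<Rightarrow> int) \<Rightarrow> formal_product set" where
  "election_processes k N = {P. (revision k N)\<^sup>*\<^sup>* (initial_product k N) P}"

text \<open>Plane binary trees without labels are trees labelled by \<open>unit\<close>. A single vertex is
  \<open>Leaf\<close>, and \<open>size1\<close> counts the leaves.\<close>

definition binary_trees :: "nat \<Rightarrow> unit tree set" where
  "binary_trees k = {t. size1 t = k}"

end

theory Submission
  imports Defs
begin

text \<open>Let the \<open>k\<close> leaves of a tree stand for the unit intervals of \<open>[0, k]\<close>. An internal node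
  covers an interval \<open>[a, c]\<close>, which its children split at a point \<open>b\<close>; it is given the symbol
  with entries \<open>N c - N a\<close> and \<open>N b - N a\<close>. In generic position the symbol determines
  \<open>(a, b, c)\<close>, and these triples determine the tree. The initial product belongs to the left comb,
  a revision is a right rotation at some node, and right rotations lead from the left comb to
  every tree.\<close>

section \<open>Trees as multisets of interval splits\<close>

fun tree_splits :: "nat \<Rightarrow> 'a tree \<Rightarrow> (nat \<times> nat \<times> nat) multiset" where
  "tree_splits i Leaf = {#}"
| "tree_splits i (Node l x r) =
    {#(i, i + size1 l, i + size1 l + size1 r)#} + tree_splits i l + tree_splits (i + size1 l) r"

lemma size1_neq_0 [simp]: "size1 t \<noteq> 0"
  by (cases t) simp_all

lemma tree_splits_bounds:
  "(a, b, c) \<in># tree_splits i t \<Longrightarrow> i \<le> a \<and> a < b \<and> b < c \<and> c \<le> i + size1 t"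
proof (induction t arbitrary: i)
  case Leaf
  then show ?case by simp
next
  case (Node l x r)
  have pos: "size1 l > 0" "size1 r > 0" by simp_all
  from Node.prems consider (root) "a = i" "b = i + size1 l" "c = i + size1 l + size1 r"
    | (left) "(a, b, c) \<in># tree_splits i l" | (right) "(a, b, c) \<in># tree_splits (i + size1 l) r"
    by auto
  then show ?case
  proof cases
    case root
    with pos show ?thesis by simp
  next
    case left
    from Node.IH(1)[OF this] show ?thesis by simp
  next
    case right
    from Node.IH(2)[OF this] show ?thesis by simp
  qed
qed

text \<open>By \<open>tree_splits_bounds\<close> the splits of either child stay inside a proper
  part of the interval of the root, so only the root can span all of it.\<close>

lemma tree_splits_root:
  assumes "(i, b, i + size1 t) \<in># tree_splits i t"
  obtains l x r where "t = Node l x r" and "b = i + size1 l"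
proof (cases t)
  case Leaf
  with assms show ?thesis by simp
next
  case (Node l x r)
  have "size1 l > 0" "size1 r > 0" by simp_all
  then have "(i, b, i + size1 t) \<notin># tree_splits i l"
    and "(i, b, i + size1 t) \<notin># tree_splits (i + size1 l) r"
    using tree_splits_bounds[of i b "i + size1 t" i l]
      tree_splits_bounds[of i b "i + size1 t" "i + size1 l" r] Node by auto
  then have "b = i + size1 l" using assms Node by simp
  with Node show ?thesis by (rule that)
qed

text \<open>The split point of the root separates the children: splits from the left end at or
  before it, splits from the right start at or after it, and the root itself straddles it.\<close>

lemma tree_splits_filter:
  "filter_mset (\<lambda>(a, b, c). c \<le> i + size1 l) (tree_splits i (Node l x r)) = tree_splits i l"
  "filter_mset (\<lambda>(a, b, c). i + size1 l \<le> a) (tree_splits i (Node l x r)) =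
    tree_splits (i + size1 l) r"
proof -
  have l: "i \<le> a \<and> a < i + size1 l \<and> c \<le> i + size1 l" if "(a, b, c) \<in># tree_splits i l" for a b c
    using tree_splits_bounds[OF that] by linarith
  have r: "i + size1 l \<le> a \<and> i + size1 l < c" if "(a, b, c) \<in># tree_splits (i + size1 l) r" for a b c
    using tree_splits_bounds[OF that] by linarith
  have "filter_mset (\<lambda>(a, b, c). c \<le> i + size1 l) (tree_splits i l) = tree_splits i l"
    "filter_mset (\<lambda>(a, b, c). c \<le> i + size1 l) (tree_splits (i + size1 l) r) = {#}"
    using l r by (fastforce simp: filter_mset_eq_conv)+
  then show
    "filter_mset (\<lambda>(a, b, c). c \<le> i + size1 l) (tree_splits i (Node l x r)) = tree_splits i l"
    by (simp del: filter_mset_eq_mempty_iff)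
  have "filter_mset (\<lambda>(a, b, c). i + size1 l \<le> a) (tree_splits i l) = {#}"
    "filter_mset (\<lambda>(a, b, c). i + size1 l \<le> a) (tree_splits (i + size1 l) r) =
      tree_splits (i + size1 l) r"
    using l r by (fastforce simp: filter_mset_eq_conv)+
  then show "filter_mset (\<lambda>(a, b, c). i + size1 l \<le> a) (tree_splits i (Node l x r)) =
      tree_splits (i + size1 l) r"
    by (simp del: filter_mset_eq_mempty_iff)
qed

lemma tree_splits_inject:
  fixes t t' :: "unit tree"
  assumes "tree_splits i t = tree_splits i t'" and "size1 t = size1 t'"
  shows "t = t'"
  using assms
proof (induction t arbitrary: i t')
  case Leaf
  then show ?case by (cases t') simp_all
next
  case (Node l x r)
  \<comment> \<open>The root split of \<open>Node l x r\<close> spans the whole interval, so it must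
    also be the root split of \<open>t'\<close>.\<close>
  have "(i, i + size1 l, i + size1 t') \<in># tree_splits i t'"
    unfolding Node.prems(1)[symmetric] Node.prems(2)[symmetric] by simp
  then obtain l' x' r' where t': "t' = Node l' x' r'" and "i + size1 l = i + size1 l'"
    by (rule tree_splits_root)
  then have l: "size1 l' = size1 l" by simp
  with Node.prems(2) t' have r: "size1 r' = size1 r" by simp
  have "tree_splits i l = tree_splits i l'"
    using tree_splits_filter(1)[of i l x r] tree_splits_filter(1)[of i l' x' r']
    unfolding Node.prems(1) t' l by (rule trans[OF sym])
  moreover have "tree_splits (i + size1 l) r = tree_splits (i + size1 l) r'"
    using tree_splits_filter(2)[of i l x r] tree_splits_filter(2)[of i l' x' r']
    unfolding Node.prems(1) t' l by (rule trans[OF sym])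
  ultimately show ?case
    using Node.IH l r t' by simp
qed

text \<open>The interval \<open>[a, m]\<close> is the left part of \<open>[a, j]\<close>, so the
  second split belongs to the left child of the node of the first, and a right rotation at that node
  does the exchange. Adding the old splits on the left avoids multiset subtraction.\<close>

lemma tree_splits_rotate:
  fixes t :: "'a tree"
  assumes "(a, m, j) \<in># tree_splits i t" and "(a, p, m) \<in># tree_splits i t"
  obtains t' :: "'a tree" where "size1 t' = size1 t"
    and "tree_splits i t' + {#(a, m, j), (a, p, m)#} = tree_splits i t + {#(a, p, j), (p, m, j)#}"
proof -
  have "\<exists>t' :: 'a tree. size1 t' = size1 t \<and>
    tree_splits i t' + {#(a, m, j), (a, p, m)#} = tree_splits i t + {#(a, p, j), (p, m, j)#}"
    using assms
  proof (induction t arbitrary: i)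
    case Leaf
    then show ?case by simp
  next
    case (Node l x r)
    have pos: "size1 l > 0" "size1 r > 0" by simp_all
    from Node.prems(1)
    consider (root) "a = i" "m = i + size1 l" "j = i + size1 l + size1 r"
      | (left) "(a, m, j) \<in># tree_splits i l" | (right) "(a, m, j) \<in># tree_splits (i + size1 l) r"
      by auto
    then show ?case
    proof cases
      case root
      \<comment> \<open>Splits of \<open>r\<close> start at \<open>i + size1 l\<close> or later, but
        \<open>a = i\<close>; and the root ends after \<open>m\<close>. This leaves
        \<open>l\<close>, whose whole interval is spanned.\<close>
      have "(a, p, m) \<notin># tree_splits (i + size1 l) r"
        using tree_splits_bounds[of a p m "i + size1 l" r] root pos by auto
      then have "(i, p, i + size1 l) \<in># tree_splits i l"
        using Node.prems(2) root pos by auto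
      then obtain l1 y l2 where l: "l = Node l1 y l2" "p = i + size1 l1"
        by (rule tree_splits_root)
      show ?thesis
        using root l by (intro exI[of _ "Node l1 x (Node l2 y r)"]) (simp add: add.assoc)
    next
      case left
      \<comment> \<open>The interval \<open>[a, m]\<close> lies inside that of \<open>l\<close>,
        which rules out the root and \<open>r\<close>.\<close>
      then have "(a, p, m) \<in># tree_splits i l"
        using Node.prems(2) pos tree_splits_bounds[OF left]
          tree_splits_bounds[of a p m "i + size1 l" r] by auto
      with left Node.IH(1) obtain l' :: "'a tree" where "size1 l' = size1 l"
        "tree_splits i l' + {#(a, m, j), (a, p, m)#} = tree_splits i l + {#(a, p, j), (p, m, j)#}"
        by blast
      then show ?thesis
        by (intro exI[of _ "Node l' x r"]) (simp add: union_ac)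
    next
      case right
      then have "(a, p, m) \<in># tree_splits (i + size1 l) r"
        using Node.prems(2) pos tree_splits_bounds[OF right]
          tree_splits_bounds[of a p m i l] by auto
      with right Node.IH(2) obtain r' :: "'a tree" where "size1 r' = size1 r"
        "tree_splits (i + size1 l) r' + {#(a, m, j), (a, p, m)#} =
          tree_splits (i + size1 l) r + {#(a, p, j), (p, m, j)#}"
        by blast
      then show ?thesis
        by (intro exI[of _ "Node l x r'"]) (simp add: union_ac)
    qed
  qed
  with that show ?thesis by blast
qed

section \<open>Symbols of splits, and revisions of tree products\<close>

definition split_symbol :: "(nat \<Rightarrow> int) \<Rightarrow> nat \<times> nat \<times> nat \<Rightarrow> binom_symbol" where
  "split_symbol N = (\<lambda>(a, b, c). Binom (N c - N a) (N b - N a))"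

text \<open>Generic position recovers \<open>(c, a)\<close> from the first entry; then the second
  entry gives \<open>N b\<close>, and strict monotonicity gives \<open>b\<close>.\<close>

lemma split_symbol_inject:
  assumes "strict_mono_on {0..k} N" and "generic_position k N"
    and "split_symbol N (a, b, c) = split_symbol N (a', b', c')"
    and "a < b" "b < c" "c \<le> k" "a' < b'" "b' < c'" "c' \<le> k"
  shows "(a, b, c) = (a', b', c')"
proof -
  have "N c - N a = N c' - N a'" and b: "N b - N a = N b' - N a'"
    using assms(3) by (simp_all add: split_symbol_def)
  then have "(c, a) = (c', a')"
    using assms(2,4-9) unfolding generic_position_def by (meson less_trans)
  moreover from this have "N b = N b'" using b by simp
  then have "b = b'"
    using inj_onD[OF strict_mono_on_imp_inj_on[OF assms(1)]] assms(4-9) by auto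
  ultimately show ?thesis by simp
qed

definition tree_product :: "(nat \<Rightarrow> int) \<Rightarrow> nat \<Rightarrow> 'a tree \<Rightarrow> formal_product" where
  "tree_product N i t = image_mset (split_symbol N) (tree_splits i t)"

lemma inj_on_tree_product:
  assumes "strict_mono_on {0..k} N" and "generic_position k N"
  shows "inj_on (tree_product N 0) (binary_trees k)"
proof (rule inj_onI)
  fix t t' :: "unit tree"
  assume t: "t \<in> binary_trees k" "t' \<in> binary_trees k"
    and eq: "tree_product N 0 t = tree_product N 0 t'"
  \<comment> \<open>On the valid triples \<open>V\<close> the symbol map has an inverse; applied
    factor by factor, it turns a tree product back into the splits of the tree.\<close>
  define V where "V = {(a, b, c) | a b c. a < b \<and> b < c \<and> c \<le> k}"
  have inj: "inj_on (split_symbol N) V"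
    using split_symbol_inject[OF assms] unfolding V_def inj_on_def by blast
  have inv: "image_mset (inv_into V (split_symbol N)) (tree_product N 0 s) = tree_splits 0 s"
    if "s \<in> binary_trees k" for s
  proof -
    have "x \<in> V" if "x \<in># tree_splits 0 s" for x
      using that \<open>s \<in> binary_trees k\<close> tree_splits_bounds[of _ _ _ 0 s]
      by (cases x) (auto simp: V_def binary_trees_def)
    then show ?thesis
      unfolding tree_product_def image_mset.compositionality
      by (intro multiset.map_ident_strong) (simp add: inv_into_f_f[OF inj])
  qed
  have "tree_splits 0 t = tree_splits 0 t'"
    using inv[OF t(1)] inv[OF t(2)] eq by simp
  then show "t = t'"
    using t by (intro tree_splits_inject) (simp_all add: binary_trees_def)
qed

text \<open>A revision consumes two symbols of valid triples. By \<open>split_symbol_inject\<close>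
  these triples are splits of \<open>t\<close> itself, so \<open>tree_splits_rotate\<close>
  applies.\<close>

lemma revision_tree_product:
  fixes t :: "'a tree"
  assumes "strict_mono_on {0..k} N" and "generic_position k N" and "size1 t = k"
    and "revision k N (tree_product N 0 t) Q"
  obtains t' :: "'a tree" where "size1 t' = k" and "Q = tree_product N 0 t'"
  using assms(4)
proof cases
  case (1 j m p i M)
  let ?a = "i - 1" and ?p = "p - 1"
  have mem: "(a, b, c) \<in># tree_splits 0 t"
    if prem: "split_symbol N (a, b, c) \<in># tree_product N 0 t" and lt: "a < b" "b < c" "c \<le> k" for a b c
  proof -
    obtain a' b' c' where y: "(a', b', c') \<in># tree_splits 0 t"
      and eq: "split_symbol N (a, b, c) = split_symbol N (a', b', c')"
      using prem by (auto simp: tree_product_def)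
    have "(a, b, c) = (a', b', c')"
      using split_symbol_inject[OF assms(1,2) eq] lt tree_splits_bounds[OF y] assms(3)
      by simp
    with y show ?thesis by simp
  qed
  have "split_symbol N (?a, m, j) \<in># tree_product N 0 t"
    "split_symbol N (?a, ?p, m) \<in># tree_product N 0 t"
    unfolding 1(1) by (simp_all add: split_symbol_def)
  then have "(?a, m, j) \<in># tree_splits 0 t" "(?a, ?p, m) \<in># tree_splits 0 t"
    using 1(3-7) by (simp_all add: mem)
  then obtain t' :: "'a tree" where t': "size1 t' = size1 t" and
    "tree_splits 0 t' + {#(?a, m, j), (?a, ?p, m)#} = tree_splits 0 t + {#(?a, ?p, j), (?p, m, j)#}"
    by (rule tree_splits_rotate)
  from arg_cong[OF this(2), of "image_mset (split_symbol N)"]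
  have "tree_product N 0 t' + image_mset (split_symbol N) {#(?a, m, j), (?a, ?p, m)#} =
    tree_product N 0 t + image_mset (split_symbol N) {#(?a, ?p, j), (?p, m, j)#}"
    by (simp add: tree_product_def)
  \<comment> \<open>The product of \<open>t\<close> is \<open>M\<close> plus the two consumed
    symbols, which cancel from both sides.\<close>
  then have "Q = tree_product N 0 t'"
    unfolding 1(1,2) by (simp add: split_symbol_def)
  moreover have "size1 t' = k" using t' assms(3) by simp
  ultimately show ?thesis by (rule that[rotated])
qed

section \<open>From the left comb to every tree\<close>

lemma revision_add:
  assumes "revision k N P Q"
  shows "revision k N (P + R) (Q + R)"
  using assms
proof cases
  case (1 j m p i M)
  from revision.intros[OF 1(3-7), of N "M + R"] show ?thesis
    unfolding 1(1,2) by (simp add: union_ac)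
qed

lemma revisions_add:
  "(revision k N)\<^sup>*\<^sup>* P Q \<Longrightarrow> (revision k N)\<^sup>*\<^sup>* (P + R) (Q + R)"
  by (induction rule: rtranclp_induct) (auto intro: revision_add rtranclp.rtrancl_into_rtrancl)

text \<open>The revision rule in terms of split points: its indices \<open>i\<close> and
  \<open>p\<close> are one more than the points \<open>a\<close> and \<open>p\<close> here.\<close>

lemma revision_split_symbol:
  assumes "a < p" "p < m" "m < j" "j \<le> k"
  shows "revision k N
    (M + {#split_symbol N (a, m, j), split_symbol N (a, p, m)#})
    (M + {#split_symbol N (a, p, j), split_symbol N (p, m, j)#})"
  using revision.intros[of j k m "Suc p" "Suc a" N M] assms by (simp add: split_symbol_def)

text \<open>For \<open>n > 0\<close> this belongs to the left comb with \<open>n\<close> leaves on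
  \<open>[i, i + n]\<close>: every node starts at \<open>i\<close> and has a leaf as its right
  child.\<close>

definition comb_product :: "(nat \<Rightarrow> int) \<Rightarrow> nat \<Rightarrow> nat \<Rightarrow> formal_product" where
  "comb_product N i n = image_mset (\<lambda>q. split_symbol N (i, q, Suc q)) (mset_set {i<..<i + n})"

lemma comb_product_Suc_0: "comb_product N i (Suc 0) = {#}"
proof -
  have "{i<..<Suc i} = {}" by auto
  then show ?thesis by (simp add: comb_product_def)
qed

lemma comb_product_Suc:
  assumes "n > 0"
  shows "comb_product N i (Suc n) =
    comb_product N i n + {#split_symbol N (i, i + n, Suc (i + n))#}"
proof -
  have "{i<..<i + Suc n} = insert (i + n) {i<..<i + n}" using assms by auto
  then show ?thesis by (simp add: comb_product_def)
qed

text \<open>The right part grows by one leaf at a time. The longer comb has a new root; below it the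
  induction hypothesis puts a node split at \<open>i + n\<close>. Rotating the two moves that split
  to the root and the new one to the top of the right comb.\<close>

lemma comb_product_split:
  assumes "n > 0" and "r > 0" and "i + n + r \<le> k"
  shows "(revision k N)\<^sup>*\<^sup>* (comb_product N i (n + r))
    ({#split_symbol N (i, i + n, i + n + r)#} + comb_product N i n + comb_product N (i + n) r)"
  using assms(2,3)
proof (induction r rule: nat_induct_non_zero)
  case 1
  then show ?case
    using assms(1) by (simp add: comb_product_Suc comb_product_Suc_0)
next
  case (Suc r)
  let ?last = "split_symbol N (i, i + n + r, Suc (i + n + r))"
  let ?M = "comb_product N i n + comb_product N (i + n) r"
  have "comb_product N i (n + Suc r) = comb_product N i (n + r) + {#?last#}"
    using comb_product_Suc[of "n + r" N i] assms(1) by (simp add: add.assoc)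
  moreover have "(revision k N)\<^sup>*\<^sup>* \<dots>
    (({#split_symbol N (i, i + n, i + n + r)#} + comb_product N i n + comb_product N (i + n) r)
      + {#?last#})"
    by (rule revisions_add, rule Suc.IH) (use Suc.prems in simp)
  moreover have "\<dots> = ?M + {#?last, split_symbol N (i, i + n, i + n + r)#}"
    by simp
  moreover have "revision k N \<dots> (?M + {#split_symbol N (i, i + n, Suc (i + n + r)),
      split_symbol N (i + n, i + n + r, Suc (i + n + r))#})"
    by (rule revision_split_symbol) (use assms(1) Suc in auto)
  moreover have "\<dots> = {#split_symbol N (i, i + n, i + n + Suc r)#} + comb_product N i n
      + comb_product N (i + n) (Suc r)"
    using comb_product_Suc[of r N "i + n"] Suc.hyps by simp
  ultimately show ?case by (metis rtranclp.rtrancl_into_rtrancl)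
qed

text \<open>The comb is first split where the root of \<open>t\<close> splits; the two smaller combs
  are then revised independently, each with the other factors as a fixed context.\<close>

lemma revisions_comb_tree_product:
  "i + size1 t \<le> k \<Longrightarrow> (revision k N)\<^sup>*\<^sup>* (comb_product N i (size1 t)) (tree_product N i t)"
proof (induction t arbitrary: i)
  case Leaf
  then show ?case by (simp add: comb_product_Suc_0 tree_product_def)
next
  case (Node l x r)
  let ?root = "{#split_symbol N (i, i + size1 l, i + size1 l + size1 r)#}"
  have "(revision k N)\<^sup>*\<^sup>* (comb_product N i (size1 l + size1 r))
    (?root + comb_product N i (size1 l) + comb_product N (i + size1 l) (size1 r))"
    using Node.prems by (intro comb_product_split) simp_all
  also have "(revision k N)\<^sup>*\<^sup>* \<dots>
    (?root + tree_product N i l + comb_product N (i + size1 l) (size1 r))"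
    using revisions_add[OF Node.IH(1)[of i],
        of "?root + comb_product N (i + size1 l) (size1 r)"] Node.prems
    by (simp add: union_ac)
  also have "(revision k N)\<^sup>*\<^sup>* \<dots>
    (?root + tree_product N i l + tree_product N (i + size1 l) r)"
    using revisions_add[OF Node.IH(2)[of "i + size1 l"],
        of "?root + tree_product N i l"] Node.prems
    by (simp add: union_ac)
  finally show ?case by (simp add: tree_product_def)
qed

lemma initial_product_eq_comb_product:
  assumes "N 0 = 0"
  shows "initial_product k N = comb_product N 0 k"
proof -
  have "{1..<k} = {0<..<0 + k}" by auto
  \<comment> \<open>Since \<open>N 0 = 0\<close>, the factor \<open>Binom (N (j + 1)) (N j)\<close>
    is the symbol of the split \<open>(0, j, Suc j)\<close>.\<close>
  then show ?thesis
    using assms by (simp add: initial_product_def comb_product_def split_symbol_def)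
qed

lemma comb_product_eq_tree_product:
  assumes "n > 0"
  shows "\<exists>t :: unit tree. size1 t = n \<and> comb_product N i n = tree_product N i t"
  using assms
proof (induction n rule: nat_induct_non_zero)
  case 1
  show ?case by (rule exI[of _ Leaf]) (simp add: comb_product_Suc_0 tree_product_def)
next
  case (Suc n)
  then obtain t :: "unit tree" where "size1 t = n" "comb_product N i n = tree_product N i t"
    by blast
  then show ?case
    using comb_product_Suc[OF Suc.hyps, of N i]
    \<comment> \<open>A new root with a leaf on its right extends the comb by one interval.\<close>
    by (intro exI[of _ "Node t () Leaf"]) (simp add: tree_product_def)
qed

theorem lemma8p1:
  fixes k :: nat and N :: "nat \<Rightarrow> int"
  assumes "k \<ge> 1"
    and "N 0 = 0"
    and "strict_mono_on {0..k} N"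
    and "generic_position k N"
  shows "\<exists>f. bij_betw f (binary_trees k) (election_processes k N)"
proof (intro exI bij_betw_imageI)
  show "inj_on (tree_product N 0) (binary_trees k)"
    using assms(3,4) by (rule inj_on_tree_product)
  \<comment> \<open>Being the product of a tree with \<open>k\<close> leaves holds initially and is
    preserved by revisions.\<close>
  have "P \<in> tree_product N 0 ` binary_trees k"
    if "(revision k N)\<^sup>*\<^sup>* (initial_product k N) P" for P
    using that
  proof (induction rule: rtranclp_induct)
    case base
    then show ?case
      using comb_product_eq_tree_product[of k N 0] assms(1)
      by (auto simp: initial_product_eq_comb_product[of N, OF assms(2)] binary_trees_def)
  next
    case (step P Q)
    then obtain t :: "unit tree" where t: "size1 t = k" "P = tree_product N 0 t"
      by (auto simp: binary_trees_def)
    from step.hyps(2) obtain t' :: "unit tree" where "size1 t' = k" "Q = tree_product N 0 t'"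
      unfolding t(2) by (rule revision_tree_product[OF assms(3,4) t(1)])
    then show ?case by (auto simp: binary_trees_def)
  qed
  moreover have "tree_product N 0 t \<in> election_processes k N" if "t \<in> binary_trees k" for t
    using revisions_comb_tree_product[of 0 t k N] that
    by (simp add: election_processes_def initial_product_eq_comb_product[of N, OF assms(2)]
        binary_trees_def)
  ultimately show "tree_product N 0 ` binary_trees k = election_processes k N"
    by (auto simp: election_processes_def)
qed

end
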